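(* Let $n=2+2k$ with $k\ge1$ an integer, let $\ell>0$, $r_0>0$, $a\in\mathbb{R}$, $V(r)=\frac{r^2}{\ell^2}\left(1+\frac{a}{r^{n-1}}-\frac{r_0^n}{r^n}\right)$, and let $r_+>0$ be the largest positive root of $V$. Let $M=\mathbb{R}^2\times T^{n-2}$ be the manifold carrying the complete metric $$g=\frac1V dr^2+Vd\phi^2+r^2\sum_{i=1}^{n-2}(d\theta^i)^2,\qquad r\ge r_+,$$ where the $\theta^i$ are periodic with arbitrary periods and $\phi$ has period $\beta=\frac{4\pi\ell^2}{r_+\left(n-1+r_0^n/r_+^n\right)}$. Let $J$ be the integrable, $g$-compatible almost-complex structure on $M$ which on $\{r>r_+\}$ is determined (acting on $1$-forms, $J^2=-\mathrm{Id}$) by $$\frac1V dr\longmapsto d\phi,\qquad d\theta^j\longmapsto d\theta^{k+j},\quad 1\le j\le k,$$ and is extended smoothly to $r=r_+$. Then $g$ is not Kähler with respect to $J$.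
   Context: $V>0$ on $(r_+,\infty)$, $V(r_+)=0$ and $V'(r_+)=4\pi/\beta>0$. The smooth structure of $M$ near the locus $r=r_+$ (where the $\phi$-circles collapse) is given by coordinates $(x,y,\theta^1,\dots,\theta^{n-2})$ with $x=\rho\cos\Phi$, $y=\rho\sin\Phi$, $\rho=V(r)^{1/2}$, $\Phi=2\pi\phi/\beta$; the locus $r=r_+$ corresponds to $(x,y)=(0,0)$; both $g$ and $J$ extend smoothly across it. $g$ is Kähler with respect to $J$ if the $2$-form $g(\cdot,J\cdot)$ is closed. *)

theory Defs
  imports "HOL-Analysis.Analysis"
begin

section \<open>Smooth functions and calculus on open subsets of a normed space\<close>

text \<open>All sets on which smoothness is asserted below are open, so derivatives are taken with
  respect to \<^term>\<open>at x\<close>.\<close>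

primrec Ck_on :: "nat \<Rightarrow> ('a::real_normed_vector \<Rightarrow> 'b::real_normed_vector) \<Rightarrow> 'a set \<Rightarrow> bool" where
  "Ck_on 0 f S \<longleftrightarrow> continuous_on S f"
| "Ck_on (Suc m) f S \<longleftrightarrow>
     (\<forall>x\<in>S. f differentiable (at x)) \<and> (\<forall>v. Ck_on m (\<lambda>x. frechet_derivative f (at x) v) S)"

definition smooth_on :: "'a set \<Rightarrow> ('a::real_normed_vector \<Rightarrow> 'b::real_normed_vector) \<Rightarrow> bool" where
  "smooth_on S f \<longleftrightarrow> (\<forall>m. Ck_on m f S)"

definition lie_bracket :: "('a::real_normed_vector \<Rightarrow> 'a) \<Rightarrow> ('a \<Rightarrow> 'a) \<Rightarrow> 'a \<Rightarrow> 'a" where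
  "lie_bracket X Y p =
     frechet_derivative Y (at p) (X p) - frechet_derivative X (at p) (Y p)"

definition nijenhuis ::
  "('a::real_normed_vector \<Rightarrow> 'a \<Rightarrow> 'a) \<Rightarrow> ('a \<Rightarrow> 'a) \<Rightarrow> ('a \<Rightarrow> 'a) \<Rightarrow> 'a \<Rightarrow> 'a" where
  "nijenhuis J X Y p =
     lie_bracket (\<lambda>q. J q (X q)) (\<lambda>q. J q (Y q)) p
     - J p (lie_bracket (\<lambda>q. J q (X q)) Y p)
     - J p (lie_bracket X (\<lambda>q. J q (Y q)) p)
     - lie_bracket X Y p"

text \<open>Exterior derivative of a 2-form, evaluated on three constant vector fields; these commute,
  so the bracket terms of the invariant formula drop out.\<close>

definition ext_deriv2 ::
  "('a::real_normed_vector \<Rightarrow> 'a \<Rightarrow> 'a \<Rightarrow> real) \<Rightarrow> 'a \<Rightarrow> 'a \<Rightarrow> 'a \<Rightarrow> 'a \<Rightarrow> real" where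
  "ext_deriv2 \<omega> p u v w =
     frechet_derivative (\<lambda>q. \<omega> q v w) (at p) u
     - frechet_derivative (\<lambda>q. \<omega> q u w) (at p) v
     + frechet_derivative (\<lambda>q. \<omega> q u v) (at p) w"

section \<open>Charts and tensor fields\<close>

text \<open>A chart is a pair of a domain \<open>U\<close> and a coordinate map \<open>c\<close>. A tensor field on a manifold
  with a given atlas is the family of its coordinate expressions, one for each chart,
  which transform into each other under changes of coordinates.\<close>

type_synonym ('m, 'e) chart = "'m set \<times> ('m \<Rightarrow> 'e)"
type_synonym ('m, 'e) bilinear_field = "('m, 'e) chart \<Rightarrow> 'e \<Rightarrow> 'e \<Rightarrow> 'e \<Rightarrow> real"
type_synonym ('m, 'e) endo_field = "('m, 'e) chart \<Rightarrow> 'e \<Rightarrow> 'e \<Rightarrow> 'e"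

definition is_chart ::
  "'m::topological_space set \<Rightarrow> ('m, 'e::euclidean_space) chart \<Rightarrow> bool" where
  "is_chart M \<kappa> \<longleftrightarrow>
     openin (top_of_set M) (fst \<kappa>) \<and> open (snd \<kappa> ` fst \<kappa>) \<and>
     homeomorphism (fst \<kappa>) (snd \<kappa> ` fst \<kappa>) (snd \<kappa>) (the_inv_into (fst \<kappa>) (snd \<kappa>))"

definition transition :: "('m, 'e) chart \<Rightarrow> ('m, 'e) chart \<Rightarrow> 'e \<Rightarrow> 'e" where
  "transition \<kappa> \<kappa>' = snd \<kappa>' \<circ> the_inv_into (fst \<kappa>) (snd \<kappa>)"

definition smooth_bilinear_field ::
  "('m, 'e::euclidean_space) chart set \<Rightarrow> ('m, 'e) bilinear_field \<Rightarrow> bool" where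
  "smooth_bilinear_field A g \<longleftrightarrow>
     (\<forall>\<kappa>\<in>A. (\<forall>q \<in> snd \<kappa> ` fst \<kappa>. bilinear (g \<kappa> q)) \<and>
            (\<forall>u v. smooth_on (snd \<kappa> ` fst \<kappa>) (\<lambda>q. g \<kappa> q u v))) \<and>
     (\<forall>\<kappa>\<in>A. \<forall>\<kappa>'\<in>A. \<forall>p \<in> fst \<kappa> \<inter> fst \<kappa>'. \<forall>u v.
        let D = frechet_derivative (transition \<kappa> \<kappa>') (at (snd \<kappa> p))
        in g \<kappa> (snd \<kappa> p) u v = g \<kappa>' (snd \<kappa>' p) (D u) (D v))"

definition smooth_endo_field ::
  "('m, 'e::euclidean_space) chart set \<Rightarrow> ('m, 'e) endo_field \<Rightarrow> bool" where
  "smooth_endo_field A J \<longleftrightarrow>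
     (\<forall>\<kappa>\<in>A. (\<forall>q \<in> snd \<kappa> ` fst \<kappa>. linear (J \<kappa> q)) \<and>
            (\<forall>v. smooth_on (snd \<kappa> ` fst \<kappa>) (\<lambda>q. J \<kappa> q v))) \<and>
     (\<forall>\<kappa>\<in>A. \<forall>\<kappa>'\<in>A. \<forall>p \<in> fst \<kappa> \<inter> fst \<kappa>'. \<forall>v.
        let D = frechet_derivative (transition \<kappa> \<kappa>') (at (snd \<kappa> p))
        in D (J \<kappa> (snd \<kappa> p) v) = J \<kappa>' (snd \<kappa>' p) (D v))"

definition riemannian_metric ::
  "('m, 'e::euclidean_space) chart set \<Rightarrow> ('m, 'e) bilinear_field \<Rightarrow> bool" where
  "riemannian_metric A g \<longleftrightarrow>
     smooth_bilinear_field A g \<and>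
     (\<forall>\<kappa>\<in>A. \<forall>q \<in> snd \<kappa> ` fst \<kappa>.
        (\<forall>u v. g \<kappa> q u v = g \<kappa> q v u) \<and> (\<forall>u. u \<noteq> 0 \<longrightarrow> g \<kappa> q u u > 0))"

definition almost_complex_structure ::
  "('m, 'e::euclidean_space) chart set \<Rightarrow> ('m, 'e) endo_field \<Rightarrow> bool" where
  "almost_complex_structure A J \<longleftrightarrow>
     smooth_endo_field A J \<and>
     (\<forall>\<kappa>\<in>A. \<forall>q \<in> snd \<kappa> ` fst \<kappa>. \<forall>v. J \<kappa> q (J \<kappa> q v) = - v)"

text \<open>The Nijenhuis expression is tensorial, so constant coordinate fields suffice.\<close>

definition integrable_acs ::
  "('m, 'e::euclidean_space) chart set \<Rightarrow> ('m, 'e) endo_field \<Rightarrow> bool" where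
  "integrable_acs A J \<longleftrightarrow>
     (\<forall>\<kappa>\<in>A. \<forall>q \<in> snd \<kappa> ` fst \<kappa>. \<forall>u v. nijenhuis (J \<kappa>) (\<lambda>_. u) (\<lambda>_. v) q = 0)"

definition compatible ::
  "('m, 'e::euclidean_space) chart set \<Rightarrow> ('m, 'e) bilinear_field \<Rightarrow> ('m, 'e) endo_field \<Rightarrow> bool" where
  "compatible A g J \<longleftrightarrow>
     (\<forall>\<kappa>\<in>A. \<forall>q \<in> snd \<kappa> ` fst \<kappa>. \<forall>u v. g \<kappa> q (J \<kappa> q u) (J \<kappa> q v) = g \<kappa> q u v)"

definition closed_2form ::
  "('m, 'e::euclidean_space) chart set \<Rightarrow> ('m, 'e) bilinear_field \<Rightarrow> bool" where
  "closed_2form A \<omega> \<longleftrightarrow>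
     (\<forall>\<kappa>\<in>A. \<forall>q \<in> snd \<kappa> ` fst \<kappa>. \<forall>u v w. ext_deriv2 (\<omega> \<kappa>) q u v w = 0)"

definition kaehler ::
  "('m, 'e::euclidean_space) chart set \<Rightarrow> ('m, 'e) bilinear_field \<Rightarrow> ('m, 'e) endo_field \<Rightarrow> bool" where
  "kaehler A g J \<longleftrightarrow> closed_2form A (\<lambda>\<kappa> q u v. g \<kappa> q u (J \<kappa> q v))"

section \<open>The manifold $M = R^2 \times T^{n-2}$\<close>

text \<open>Write $n = 2 + 2k$ with $k$ the cardinality of \<open>'k\<close>. The index set of
  $\theta^1, \dots, \theta^{n-2}$ is \<^typ>\<open>'k + 'k\<close>: \<open>Inl j\<close> stands for the index $j$ and
  \<open>Inr j\<close> for $k + j$.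

  A point of $M$ is a pair $(w, z)$ where $w = (r - r_+) e^{i\Phi}$ encodes $(r, \Phi)$ with
  the circle at $r = r_+$ collapsed, and $z_i = \exp(2\pi i\,\theta^i / L_i)$. The number $w$
  only provides the underlying set and topology; the smooth structure is
  that of the charts below.\<close>

type_synonym 'k point = "complex \<times> (complex ^ ('k + 'k))"
type_synonym 'k coords = "real \<times> real \<times> (real ^ ('k + 'k))"

definition M_space :: "'k::finite point set" where
  "M_space = {(w, z). \<forall>i. norm (z $ i) = 1}"

definition V :: "nat \<Rightarrow> real \<Rightarrow> real \<Rightarrow> real \<Rightarrow> real \<Rightarrow> real" where
  "V n l r0 a r = r^2 / l^2 * (1 + a / r^(n - 1) - r0^n / r^n)"

definition period :: "nat \<Rightarrow> real \<Rightarrow> real \<Rightarrow> real \<Rightarrow> real" where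
  "period n l r0 rp = 4 * pi * l^2 / (rp * (real n - 1 + r0^n / rp^n))"

definition largest_positive_root :: "(real \<Rightarrow> real) \<Rightarrow> real \<Rightarrow> bool" where
  "largest_positive_root f x \<longleftrightarrow> x > 0 \<and> f x = 0 \<and> (\<forall>y>0. f y = 0 \<longrightarrow> y \<le> x)"

text \<open>Charts $(r, \phi, \theta)$ on open subsets of $\{r > r_+\}$, with arbitrary continuous local
  choices of the periodic coordinates.\<close>

definition polar_charts ::
  "nat \<Rightarrow> real \<Rightarrow> real \<Rightarrow> real \<Rightarrow> real ^ ('k + 'k) \<Rightarrow> ('k::finite point, 'k coords) chart set" where
  "polar_charts n l r0 rp L =
     {(U, c). is_chart M_space (U, c) \<and>
        (\<forall>(w, z) \<in> U. case c (w, z) of (r, \<phi>, \<theta>) \<Rightarrow>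
           r > rp \<and>
           w = complex_of_real (r - rp) * cis (2 * pi * \<phi> / period n l r0 rp) \<and>
           (\<forall>i. z $ i = cis (2 * pi * \<theta> $ i / L $ i)))}"

text \<open>Charts $(x, y, \theta)$ with $x + i y = V(r)^{1/2} e^{i\Phi}$, where $r = r_+ + |w|$ and
  $e^{i\Phi}$ is \<^term>\<open>sgn w\<close>. They are confined to a region $r_+ \le r < r_+ + \delta$ on which
  $V' > 0$: for some parameters $V$ is not monotone on all of $[r_+, \infty)$.\<close>

definition cartesian_charts ::
  "nat \<Rightarrow> real \<Rightarrow> real \<Rightarrow> real \<Rightarrow> real \<Rightarrow> real ^ ('k + 'k) \<Rightarrow> ('k::finite point, 'k coords) chart set" where
  "cartesian_charts n l r0 a rp L =
     {(U, c). is_chart M_space (U, c) \<and>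
        (\<exists>\<delta>>0. (\<forall>r. rp \<le> r \<and> r < rp + \<delta> \<longrightarrow> deriv (V n l r0 a) r > 0) \<and>
                (\<forall>(w, z) \<in> U. norm w < \<delta>)) \<and>
        (\<forall>(w, z) \<in> U. case c (w, z) of (x, y, \<theta>) \<Rightarrow>
           Complex x y = complex_of_real (sqrt (V n l r0 a (rp + norm w))) * sgn w \<and>
           (\<forall>i. z $ i = cis (2 * pi * \<theta> $ i / L $ i)))}"

definition M_atlas ::
  "nat \<Rightarrow> real \<Rightarrow> real \<Rightarrow> real \<Rightarrow> real \<Rightarrow> real ^ ('k + 'k) \<Rightarrow> ('k::finite point, 'k coords) chart set" where
  "M_atlas n l r0 a rp L = polar_charts n l r0 rp L \<union> cartesian_charts n l r0 a rp L"

section \<open>The metric and the complex structure on $r > r_+$\<close>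

text \<open>The coordinate 1-forms of a chart $(r, \phi, \theta)$.\<close>

definition d_r :: "'k::finite coords \<Rightarrow> real" where "d_r v = fst v"
definition d_phi :: "'k::finite coords \<Rightarrow> real" where "d_phi v = fst (snd v)"
definition d_theta :: "'k + 'k \<Rightarrow> 'k::finite coords \<Rightarrow> real" where "d_theta i v = snd (snd v) $ i"

definition extends_soliton_metric ::
  "nat \<Rightarrow> real \<Rightarrow> real \<Rightarrow> real \<Rightarrow> real \<Rightarrow> real ^ ('k + 'k) \<Rightarrow>
   ('k::finite point, 'k coords) bilinear_field \<Rightarrow> bool" where
  "extends_soliton_metric n l r0 a rp L g \<longleftrightarrow>
     (\<forall>\<kappa> \<in> polar_charts n l r0 rp L. \<forall>q \<in> snd \<kappa> ` fst \<kappa>. \<forall>u v.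
        (let r = fst q in
         g \<kappa> q u v = 1 / V n l r0 a r * (d_r u * d_r v) + V n l r0 a r * (d_phi u * d_phi v)
                     + r^2 * (\<Sum>i\<in>UNIV. d_theta i u * d_theta i v)))"

text \<open>An endomorphism $J$ of the tangent spaces acts on a 1-form $\alpha$ by
  $(J\alpha)(v) = \alpha(Jv)$. The values of $J$ on the remaining 1-forms $d\phi$ and
  $d\theta^{k+j}$ follow from $J^2 = -1$.\<close>

definition extends_soliton_acs ::
  "nat \<Rightarrow> real \<Rightarrow> real \<Rightarrow> real \<Rightarrow> real \<Rightarrow> real ^ ('k + 'k) \<Rightarrow>
   ('k::finite point, 'k coords) endo_field \<Rightarrow> bool" where
  "extends_soliton_acs n l r0 a rp L J \<longleftrightarrow>
     (\<forall>\<kappa> \<in> polar_charts n l r0 rp L. \<forall>q \<in> snd \<kappa> ` fst \<kappa>. \<forall>v.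
        1 / V n l r0 a (fst q) * d_r (J \<kappa> q v) = d_phi v \<and>
        (\<forall>j. d_theta (Inl j) (J \<kappa> q v) = d_theta (Inr j) v))"

end

theory Submission
  imports Defs
begin

text \<open>The point is that the torus directions carry the warping factor \<open>r\<^sup>2\<close>, while \<open>J\<close> pairs
  them among themselves. On \<open>{r > r\<^sub>+}\<close> the fundamental form \<open>\<omega>(u, v) = g(u, J v)\<close> is
  \<open>dr \<and> d\<phi> + r\<^sup>2 \<Sum>\<^sub>j d\<theta>\<^sup>j \<and> d\<theta>\<^sup>k\<^sup>+\<^sup>j\<close>: the factors \<open>1/V\<close> and \<open>V\<close> cancel in the first summand,
  which is therefore closed, and what is left is
  \<open>d\<omega> = 2 r dr \<and> \<Sum>\<^sub>j d\<theta>\<^sup>j \<and> d\<theta>\<^sup>k\<^sup>+\<^sup>j\<close>. This does not vanish, because \<open>r > 0\<close> and there is at least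
  one index \<open>j\<close>.

  Only the three components of \<open>\<omega>\<close> on \<open>\<partial>\<^sub>r, \<partial>\<^sub>j, \<partial>\<^sub>k\<^sub>+\<^sub>j\<close> enter the computation; they are given by
  \<open>fundamental_form_torus\<close> and \<open>fundamental_form_radial\<close>. Closedness is a condition in each chart,
  so a contradiction also requires that a polar chart exist. One is obtained by restricting all
  angles to \<open>(-\<pi>, \<pi>)\<close> and using the principal argument, see \<open>principal_polar_chart\<close>.\<close>

section \<open>A polar chart\<close>

lemma is_chart_of_inverse:
  fixes c :: "'m::topological_space \<Rightarrow> 'e::euclidean_space"
  assumes "openin (top_of_set M) U" "open T"
    and "continuous_on U c" "continuous_on T d"
    and "c ` U \<subseteq> T" "d ` T \<subseteq> U"
    and dc: "\<And>p. p \<in> U \<Longrightarrow> d (c p) = p" and "\<And>q. q \<in> T \<Longrightarrow> c (d q) = q"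
  shows "is_chart M (U, c)" and "c ` U = T"
proof -
  have hom: "homeomorphism U T c d"
    using assms by (intro homeomorphismI) auto
  then show img: "c ` U = T"
    by (simp add: homeomorphism_def)
  have "inj_on c U"
    using dc by (rule inj_on_inverseI)
  then have "the_inv_into U c q = d q" if "q \<in> T" for q
    using that img dc by (auto simp: the_inv_into_f_f)
  then have "homeomorphism U T c (the_inv_into U c)"
    by (intro homeomorphism_cong[OF hom]) auto
  then show "is_chart M (U, c)"
    using assms by (simp add: is_chart_def img)
qed

definition slit_domain :: "'k::finite point set" where
  "slit_domain = {(w, z). w \<notin> \<real>\<^sub>\<le>\<^sub>0 \<and> (\<forall>i. norm (z $ i) = 1 \<and> z $ i \<notin> \<real>\<^sub>\<le>\<^sub>0)}"

text \<open>Here \<open>\<beta>\<close> stands for the period of \<open>\<phi>\<close>. The principal argument is continuous off the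
  slit, and there it takes exactly the values in \<open>(-\<pi>, \<pi>)\<close>, so the image is a box.\<close>

definition principal_polar_coords ::
  "real \<Rightarrow> real \<Rightarrow> real ^ ('k + 'k) \<Rightarrow> 'k::finite point \<Rightarrow> 'k coords" where
  "principal_polar_coords \<beta> rp L = (\<lambda>(w, z).
     (rp + norm w, \<beta> * Arg w / (2 * pi), \<chi> i. L $ i * Arg (z $ i) / (2 * pi)))"

definition polar_point ::
  "real \<Rightarrow> real \<Rightarrow> real ^ ('k + 'k) \<Rightarrow> 'k::finite coords \<Rightarrow> 'k point" where
  "polar_point \<beta> rp L = (\<lambda>(r, \<phi>, \<theta>).
     (complex_of_real (r - rp) * cis (2 * pi * \<phi> / \<beta>), \<chi> i. cis (2 * pi * \<theta> $ i / L $ i)))"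

definition polar_box :: "real \<Rightarrow> real \<Rightarrow> real ^ ('k + 'k) \<Rightarrow> 'k::finite coords set" where
  "polar_box \<beta> rp L = {(r, \<phi>, \<theta>). r > rp \<and> \<bar>\<phi>\<bar> < \<beta> / 2 \<and> (\<forall>i. \<bar>\<theta> $ i\<bar> < L $ i / 2)}"

lemma abs_Arg_less_pi:
  assumes "z \<notin> \<real>\<^sub>\<le>\<^sub>0"
  shows "\<bar>Arg z\<bar> < pi"
proof -
  have "Arg z \<noteq> pi"
    using assms by (auto simp: Arg_eq_pi complex_nonpos_Reals_iff)
  then show ?thesis
    using mpi_less_Arg[of z] Arg_le_pi[of z] by linarith
qed

lemma rcis_notin_nonpos_Reals:
  assumes "\<bar>x\<bar> < pi" "s > 0"
  shows "of_real s * cis x \<notin> \<real>\<^sub>\<le>\<^sub>0"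
proof
  assume "of_real s * cis x \<in> \<real>\<^sub>\<le>\<^sub>0"
  moreover have "of_real s * cis x \<noteq> 0"
    using assms by simp
  ultimately have "Arg (of_real s * cis x) = pi"
    by (auto simp: Arg_eq_pi complex_nonpos_Reals_iff complex_eq_iff order_less_le)
  moreover have "Arg (of_real s * cis x) = x"
    using assms Arg_rcis[of x s] by (simp add: rcis_def abs_less_iff)
  ultimately show False
    using assms by simp
qed

lemma cis_notin_nonpos_Reals: "\<bar>x\<bar> < pi \<Longrightarrow> cis x \<notin> \<real>\<^sub>\<le>\<^sub>0"
  using rcis_notin_nonpos_Reals[of x 1] by simp

lemma abs_angle_less_pi:
  fixes x b :: real
  assumes "\<bar>x\<bar> < b / 2"
  shows "\<bar>2 * pi * x / b\<bar> < pi"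
proof -
  have "b > 0" using assms by linarith
  have "2 * \<bar>x\<bar> * pi < b * pi"
    using assms by (intro mult_strict_right_mono) auto
  then show ?thesis
    using \<open>b > 0\<close> by (simp add: abs_mult divide_less_eq mult_ac)
qed

lemma abs_coord_less_half_period:
  fixes x b :: real
  assumes "\<bar>x\<bar> < pi" "b > 0"
  shows "\<bar>b * x / (2 * pi)\<bar> < b / 2"
proof -
  have "b * \<bar>x\<bar> < b * pi"
    using assms by (intro mult_strict_left_mono) auto
  then show ?thesis
    using assms by (simp add: abs_mult divide_less_eq)
qed

lemma open_polar_box: "open (polar_box \<beta> rp L)"
proof -
  have "polar_box \<beta> rp L =
      {q. rp < fst q} \<inter> {q. \<bar>fst (snd q)\<bar> < \<beta> / 2} \<inter> (\<Inter>i. {q. \<bar>snd (snd q) $ i\<bar> < L $ i / 2})"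
    by (auto simp: polar_box_def)
  then show ?thesis
    by (auto intro!: open_Int open_INT open_Collect_less continuous_intros)
qed

lemma openin_slit_domain: "openin (top_of_set M_space) (slit_domain :: 'k::finite point set)"
proof -
  have "(slit_domain :: 'k point set) = M_space \<inter> (fst -` (- \<real>\<^sub>\<le>\<^sub>0) \<inter> (\<Inter>i. (\<lambda>p. snd p $ i) -` (- \<real>\<^sub>\<le>\<^sub>0)))"
    by (auto simp: slit_domain_def M_space_def)
  moreover have "open (fst -` (- \<real>\<^sub>\<le>\<^sub>0) \<inter> (\<Inter>i. (\<lambda>p::'k point. snd p $ i) -` (- \<real>\<^sub>\<le>\<^sub>0)))"
    by (intro open_Int open_INT open_vimage ballI finite continuous_intros)
      (auto simp: closed_nonpos_Reals_complex)
  ultimately show ?thesis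
    by (auto simp: openin_open)
qed

lemma principal_polar_chart:
  fixes L :: "real ^ ('k::finite + 'k)"
  assumes \<beta>: "\<beta> > 0" and L: "\<And>i. L $ i > 0"
  shows "is_chart M_space (slit_domain, principal_polar_coords \<beta> rp L)" (is ?chart)
    and "principal_polar_coords \<beta> rp L ` slit_domain = polar_box \<beta> rp L" (is ?image)
    and "\<And>p. p \<in> slit_domain \<Longrightarrow> polar_point \<beta> rp L (principal_polar_coords \<beta> rp L p) = p"
proof -
  let ?c = "principal_polar_coords \<beta> rp L" and ?d = "polar_point \<beta> rp L"
  have c_in: "?c p \<in> polar_box \<beta> rp L" if "p \<in> slit_domain" for p
    using that \<beta> L abs_coord_less_half_period[OF abs_Arg_less_pi]
    by (auto simp: slit_domain_def principal_polar_coords_def polar_box_def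
        simp del: times_divide_eq_right)
  have d_in: "?d q \<in> slit_domain" if "q \<in> polar_box \<beta> rp L" for q
  proof -
    obtain r \<phi> \<theta> where q: "q = (r, \<phi>, \<theta>)" by (cases q)
    have "of_real (r - rp) * cis (2 * pi * \<phi> / \<beta>) \<notin> \<real>\<^sub>\<le>\<^sub>0"
      using that by (intro rcis_notin_nonpos_Reals abs_angle_less_pi) (auto simp: q polar_box_def)
    moreover have "cis (2 * pi * \<theta> $ i / L $ i) \<notin> \<real>\<^sub>\<le>\<^sub>0" for i
      using that by (intro cis_notin_nonpos_Reals abs_angle_less_pi) (simp add: q polar_box_def)
    ultimately show ?thesis
      by (simp add: q slit_domain_def polar_point_def)
  qed
  show dc: "?d (?c p) = p" if "p \<in> slit_domain" for p
  proof -
    obtain w z where p: "p = (w, z)" by (cases p)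
    have "L $ i \<noteq> 0" for i
      using L[of i] by simp
    moreover have "cis (Arg (z $ i)) = z $ i" for i
      using that rcis_cmod_Arg[of "z $ i"] by (auto simp: p slit_domain_def rcis_def)
    ultimately show ?thesis
      using \<beta> rcis_cmod_Arg[of w]
      by (simp add: p polar_point_def principal_polar_coords_def vec_eq_iff rcis_def)
  qed
  have cd: "?c (?d q) = q" if q_in: "q \<in> polar_box \<beta> rp L" for q
  proof -
    obtain r \<phi> \<theta> where q: "q = (r, \<phi>, \<theta>)" by (cases q)
    have r: "r > rp" and \<phi>: "\<bar>2 * pi * \<phi> / \<beta>\<bar> < pi"
      and \<theta>: "\<bar>2 * pi * \<theta> $ i / L $ i\<bar> < pi" for i
      using q_in abs_angle_less_pi[of \<phi> \<beta>] abs_angle_less_pi[of "\<theta> $ i" "L $ i"]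
      by (auto simp: q polar_box_def)
    have 1: "Arg (complex_of_real (r - rp) * cis (2 * pi * \<phi> / \<beta>)) = 2 * pi * \<phi> / \<beta>"
      using r \<phi> unfolding rcis_def[symmetric] abs_less_iff by (intro Arg_rcis) auto
    have 2: "Arg (cis (2 * pi * \<theta> $ i / L $ i)) = 2 * pi * \<theta> $ i / L $ i" for i
      using \<theta>[of i] unfolding abs_less_iff by (intro Arg_cis) auto
    have "L $ i \<noteq> 0" for i
      using L[of i] by simp
    then show ?thesis
      using \<beta> r 1 2
      by (simp add: q polar_point_def principal_polar_coords_def vec_eq_iff norm_mult
          del: of_real_diff)
  qed
  have cont_c: "continuous_on slit_domain ?c"
    unfolding principal_polar_coords_def case_prod_unfold
    by (intro continuous_intros) (auto simp: slit_domain_def)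
  have cont_d: "continuous_on (polar_box \<beta> rp L) ?d"
  proof -
    have "L $ i \<noteq> 0" for i
      using L[of i] by simp
    then show ?thesis
      using \<beta> unfolding polar_point_def case_prod_unfold
      by (intro continuous_intros) auto
  qed
  note * = openin_slit_domain open_polar_box cont_c cont_d image_subsetI[OF c_in]
    image_subsetI[OF d_in] dc cd
  show ?chart by (rule is_chart_of_inverse(1)[OF *])
  show ?image by (rule is_chart_of_inverse(2)[OF *])
qed

lemma principal_polar_chart_in_polar_charts:
  fixes L :: "real ^ ('k::finite + 'k)"
  assumes "period n l r0 rp > 0" and "\<And>i. L $ i > 0"
  shows "(slit_domain, principal_polar_coords (period n l r0 rp) rp L) \<in> polar_charts n l r0 rp L"
proof -
  let ?c = "principal_polar_coords (period n l r0 rp) rp L"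
  have "\<forall>(w, z) \<in> slit_domain. case ?c (w, z) of (r, \<phi>, \<theta>) \<Rightarrow> r > rp \<and>
           w = complex_of_real (r - rp) * cis (2 * pi * \<phi> / period n l r0 rp) \<and>
           (\<forall>i. z $ i = cis (2 * pi * \<theta> $ i / L $ i))"
  proof (rule ballI, rule case_prodI2)
    fix p :: "'k point" and w z
    assume "p \<in> slit_domain" "p = (w, z)"
    then have p: "(w, z) \<in> slit_domain" by simp
    obtain r \<phi> \<theta> where q: "?c (w, z) = (r, \<phi>, \<theta>)" by (cases "?c (w, z)")
    have "(r, \<phi>, \<theta>) \<in> polar_box (period n l r0 rp) rp L"
      using principal_polar_chart(2)[OF assms, where rp = rp] p q by (metis imageI)
    moreover have "polar_point (period n l r0 rp) rp L (r, \<phi>, \<theta>) = (w, z)"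
      using principal_polar_chart(3)[OF assms p, where rp = rp] q by simp
    ultimately show "case ?c (w, z) of (r, \<phi>, \<theta>) \<Rightarrow> r > rp \<and>
           w = complex_of_real (r - rp) * cis (2 * pi * \<phi> / period n l r0 rp) \<and>
           (\<forall>i. z $ i = cis (2 * pi * \<theta> $ i / L $ i))"
      unfolding q by (auto simp: polar_box_def polar_point_def simp del: of_real_diff)
  qed
  with principal_polar_chart(1)[OF assms, of rp] show ?thesis
    unfolding polar_charts_def mem_Collect_eq case_prod_conv by (rule conjI)
qed

section \<open>The fundamental form and its exterior derivative\<close>

text \<open>Only \<open>\<partial>\<^sub>j\<close> itself pairs with \<open>\<partial>\<^sub>j\<close> under \<open>g\<close>, and \<open>J d\<theta>\<^sup>j = d\<theta>\<^sup>k\<^sup>+\<^sup>j\<close>.\<close>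

lemma fundamental_form_torus:
  fixes L :: "real ^ ('k::finite + 'k)"
  assumes "extends_soliton_metric n l r0 a rp L g" "extends_soliton_acs n l r0 a rp L J"
    and "\<kappa> \<in> polar_charts n l r0 rp L" "q \<in> snd \<kappa> ` fst \<kappa>"
  shows "g \<kappa> q (0, 0, axis (Inl j) 1) (J \<kappa> q v) = (fst q)\<^sup>2 * d_theta (Inr j) v"
proof -
  have "g \<kappa> q (0, 0, axis (Inl j) 1) (J \<kappa> q v) =
      (fst q)\<^sup>2 * (\<Sum>i\<in>UNIV. axis (Inl j) 1 $ i * d_theta i (J \<kappa> q v))"
    using assms(1)[unfolded extends_soliton_metric_def Let_def, rule_format, OF assms(3,4)]
    by (simp add: d_r_def d_phi_def d_theta_def)
  also have "(\<Sum>i\<in>UNIV. axis (Inl j) 1 $ i * d_theta i (J \<kappa> q v)) = d_theta (Inl j) (J \<kappa> q v)"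
    by (subst sum.remove[of _ "Inl j"]) (auto simp: axis_def intro!: sum.neutral)
  also have "\<dots> = d_theta (Inr j) v"
    using assms(2)[unfolded extends_soliton_acs_def, rule_format, OF assms(3,4)] by simp
  finally show ?thesis .
qed

text \<open>Pairing with \<open>\<partial>\<^sub>r\<close> is the form \<open>V\<^sup>-\<^sup>1 dr\<close>, which \<open>J\<close> sends to \<open>d\<phi>\<close>.\<close>

lemma fundamental_form_radial:
  fixes L :: "real ^ ('k::finite + 'k)"
  assumes "extends_soliton_metric n l r0 a rp L g" "extends_soliton_acs n l r0 a rp L J"
    and "\<kappa> \<in> polar_charts n l r0 rp L" "q \<in> snd \<kappa> ` fst \<kappa>"
  shows "g \<kappa> q (1, 0, 0) (J \<kappa> q v) = d_phi v"
proof -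
  have "g \<kappa> q (1, 0, 0) (J \<kappa> q v) = 1 / V n l r0 a (fst q) * d_r (J \<kappa> q v)"
    using assms(1)[unfolded extends_soliton_metric_def Let_def, rule_format, OF assms(3,4)]
    by (simp add: d_r_def d_phi_def d_theta_def)
  also have "\<dots> = d_phi v"
    using assms(2)[unfolded extends_soliton_acs_def, rule_format, OF assms(3,4)] by simp
  finally show ?thesis .
qed

lemma frechet_derivative_eqI:
  assumes "(f has_derivative f') (at x)" "open S" "x \<in> S" "\<And>y. y \<in> S \<Longrightarrow> h y = f y"
  shows "frechet_derivative h (at x) = f'"
proof -
  have "(h has_derivative f') (at x)"
    using assms by (intro has_derivative_transform_within_open[OF assms(1-3)]) auto
  then show ?thesis
    by (rule frechet_derivative_at[symmetric])
qed

lemma ext_deriv2_fundamental_form: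
  fixes L :: "real ^ ('k::finite + 'k)" and q :: "'k coords"
  assumes soliton: "extends_soliton_metric n l r0 a rp L g" "extends_soliton_acs n l r0 a rp L J"
    and \<kappa>: "\<kappa> \<in> polar_charts n l r0 rp L" and q: "q \<in> snd \<kappa> ` fst \<kappa>"
  shows "ext_deriv2 (\<lambda>q u v. g \<kappa> q u (J \<kappa> q v)) q
           (1, 0, 0) (0, 0, axis (Inl j) 1) (0, 0, axis (Inr j) 1) = 2 * fst q"
proof -
  let ?u = "(1, 0, 0) :: 'k coords"
  let ?v = "(0, 0, axis (Inl j) 1) :: 'k coords" and ?w = "(0, 0, axis (Inr j) 1) :: 'k coords"
  have "open (snd \<kappa> ` fst \<kappa>)"
    using \<kappa> by (auto simp: polar_charts_def is_chart_def)
  note derivI = frechet_derivative_eqI[OF _ this q]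
  have "frechet_derivative (\<lambda>q. g \<kappa> q ?v (J \<kappa> q ?w)) (at q) = (\<lambda>h. 2 * fst q * fst h)"
  proof (rule derivI)
    show "((\<lambda>q::'k coords. (fst q)\<^sup>2) has_derivative (\<lambda>h. 2 * fst q * fst h)) (at q)"
      by (auto intro!: derivative_eq_intros)
    show "g \<kappa> y ?v (J \<kappa> y ?w) = (fst y)\<^sup>2" if "y \<in> snd \<kappa> ` fst \<kappa>" for y
      using fundamental_form_torus[OF soliton \<kappa> that, of j ?w] by (simp add: d_theta_def)
  qed
  moreover have "frechet_derivative (\<lambda>q. g \<kappa> q ?u (J \<kappa> q x)) (at q) = (\<lambda>h. 0)" for x
    by (rule derivI[OF has_derivative_const]) (rule fundamental_form_radial[OF soliton \<kappa>])
  ultimately show ?thesis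
    by (simp add: ext_deriv2_def)
qed

theorem mainTheorem6:
  fixes n k :: nat and l r0 a rp :: real
    and L :: "real ^ ('k::finite + 'k)"
    and g :: "('k point, 'k coords) bilinear_field"
    and J :: "('k point, 'k coords) endo_field"
  assumes "k = CARD('k)" and "k \<ge> 1" and "n = 2 + 2 * k"
    and "l > 0" and "r0 > 0"
    and "largest_positive_root (V n l r0 a) rp"
    and "\<And>i. L $ i > 0"
    and "riemannian_metric (M_atlas n l r0 a rp L) g"
    and "extends_soliton_metric n l r0 a rp L g"
    and "almost_complex_structure (M_atlas n l r0 a rp L) J"
    and "extends_soliton_acs n l r0 a rp L J"
    and "integrable_acs (M_atlas n l r0 a rp L) J"
    and "compatible (M_atlas n l r0 a rp L) g J"
  shows "\<not> kaehler (M_atlas n l r0 a rp L) g J"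
proof
  assume kaehler: "kaehler (M_atlas n l r0 a rp L) g J"
  have "rp > 0"
    using assms by (simp add: largest_positive_root_def)
  moreover have "real n - 1 > 0"
    using assms by simp
  ultimately have period: "period n l r0 rp > 0"
    using assms unfolding period_def by (intro divide_pos_pos mult_pos_pos add_pos_pos) auto
  define \<kappa> :: "('k point, 'k coords) chart"
    where "\<kappa> = (slit_domain, principal_polar_coords (period n l r0 rp) rp L)"
  have \<kappa>: "\<kappa> \<in> polar_charts n l r0 rp L"
    unfolding \<kappa>_def using period assms(7) by (rule principal_polar_chart_in_polar_charts)
  define q :: "'k coords" where "q = (rp + 1, 0, 0)"
  have q: "q \<in> snd \<kappa> ` fst \<kappa>"
    unfolding \<kappa>_def fst_conv snd_conv principal_polar_chart(2)[OF period assms(7)]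
    using period assms(7) by (simp add: q_def polar_box_def)
  have "\<kappa> \<in> M_atlas n l r0 a rp L"
    using \<kappa> by (simp add: M_atlas_def)
  then have "ext_deriv2 (\<lambda>q u v. g \<kappa> q u (J \<kappa> q v)) q u v w = 0" for u v w
    using kaehler q unfolding kaehler_def closed_2form_def by blast
  then have "2 * fst q = 0"
    using ext_deriv2_fundamental_form[OF assms(9,11) \<kappa> q] by metis
  then show False
    using \<open>rp > 0\<close> by (simp add: q_def)
qed

end
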